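(* Let $r\in\mathbb{R}^m_{++}$ and $c\in\mathbb{R}^n_{++}$ have total mass one, and let $C\in\mathbb{R}^{m\times n}$ have finite entries. Let $\varepsilon>0$, let $K_\varepsilon:=\exp(-C/\varepsilon)$ (entrywise), and let $A\in\mathbb{R}^m_{++}$, $B,t\in\mathbb{R}^n_{++}$ satisfy $$A=r\oslash(K_\varepsilon t),\qquad B=c\oslash(K_\varepsilon^\top A).$$ Let $\Omega$ be any number with $\Omega\ge\operatorname{osc}(C)$. Let $Z:=\operatorname{diag}(A)K_\varepsilon\operatorname{diag}(t)$ and $s:=Z^\top\mathbf{1}_m$, and define $$f:=\varepsilon\log A,\qquad g:=\varepsilon\log(B\oslash c),\qquad \delta:=\tfrac12\|s-c\|_1,\qquad w:=(C\odot K_\varepsilon)^\top A,$$ $$L:=\langle r,f\rangle+\langle c,g\rangle,\qquad U:=\langle t,w\rangle+\Omega\delta.$$ Then $(f,g)$ is feasible for the unregularized Kantorovich dual, i.e. $f_i+g_j\le C_{ij}$ for all $i,j$. Furthermore, the intermediate plan $Z$ admits a feasible repair: there exists $\widehat Z\in\Pi(r,c)$ such that $$L\le p^\star\le\langle C,\widehat Z\rangle\le U.$$ Consequently, $$0\le\langle C,\widehat Z\rangle-p^\star\le U-L.$$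
   Context: Notation: $\odot$ and $\oslash$ are entrywise product and quotient; $\exp$ and $\log$ act entrywise; $\langle\cdot,\cdot\rangle$ is the standard (Frobenius) inner product; $\mathbf{1}$ denotes the all-ones vector; $\operatorname{osc}(C):=\max_{i,j}C_{ij}-\min_{i,j}C_{ij}$. The transportation polytope is $\Pi(r,c)=\{X\in\mathbb{R}^{m\times n}: X\ge 0,\ X\mathbf{1}_n=r,\ X^\top\mathbf{1}_m=c\}$ and the unregularized optimal transport value is $p^\star=\min_{X\in\Pi(r,c)}\langle C,X\rangle$. Its Kantorovich dual is $\max\{\langle r,f\rangle+\langle c,g\rangle: f\in\mathbb{R}^m,\ g\in\mathbb{R}^n,\ f_i+g_j\le C_{ij}\ \text{for all } i,j\}$. Under the stated normalizations, $s=t\odot(K_\varepsilon^\top A)=c\odot t\oslash B$. *)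

theory Defs
  imports "HOL-Analysis.Analysis"
begin

text \<open>
  An \<open>m \<times> n\<close> matrix has type \<open>real^'n^'m\<close>. On \<open>real^'n\<close> and on \<open>real^'n^'m\<close> the library's
  \<open>(*)\<close> is the entrywise product, \<open>(\<le>)\<close> the entrywise order, \<open>1\<close> the all-ones object and
  \<open>(\<bullet>)\<close> the standard (for matrices: Frobenius) inner product.
\<close>

definition vec_map :: "('a \<Rightarrow> 'b) \<Rightarrow> 'a^'n \<Rightarrow> 'b^'n"
  where "vec_map h x = (\<chi> i. h (x $ i))"

definition vec_quot :: "real^'n \<Rightarrow> real^'n \<Rightarrow> real^'n"  (infixl "\<oslash>" 70)
  where "x \<oslash> y = (\<chi> i. x $ i / y $ i)"

definition vec_pos :: "real^'n \<Rightarrow> bool"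
  where "vec_pos x \<longleftrightarrow> (\<forall>i. 0 < x $ i)"

definition diag_mat :: "real^'n \<Rightarrow> real^'n^'n"
  where "diag_mat x = (\<chi> i j. if i = j then x $ i else 0)"

definition l1_norm :: "real^'n \<Rightarrow> real"
  where "l1_norm x = (\<Sum>i\<in>UNIV. \<bar>x $ i\<bar>)"

definition osc :: "real^'n^'m \<Rightarrow> real"
  where "osc C = Max {C $ i $ j | i j. True} - Min {C $ i $ j | i j. True}"

definition gibbs_kernel :: "real \<Rightarrow> real^'n^'m \<Rightarrow> real^'n^'m"
  where "gibbs_kernel \<epsilon> C = map_matrix exp ((- 1 / \<epsilon>) *\<^sub>R C)"

definition transport_polytope :: "real^'m \<Rightarrow> real^'n \<Rightarrow> (real^'n^'m) set"
  where "transport_polytope r c = {X. 0 \<le> X \<and> X *v 1 = r \<and> transpose X *v 1 = c}"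

text \<open>\<open>LEAST\<close> stands for the minimum; it is attained for the marginals considered here, see
  \<open>ot_value_attained\<close> below.\<close>

definition ot_value :: "real^'m \<Rightarrow> real^'n \<Rightarrow> real^'n^'m \<Rightarrow> real"
  where "ot_value r c C = (LEAST v. \<exists>X \<in> transport_polytope r c. v = C \<bullet> X)"

definition kantorovich_dual_feasible :: "real^'n^'m \<Rightarrow> ((real^'m) \<times> (real^'n)) set"
  where "kantorovich_dual_feasible C = {(f, g). \<forall>i j. f $ i + g $ j \<le> C $ i $ j}"

lemma transport_polytope_iff:
  "X \<in> transport_polytope r c \<longleftrightarrow>
     (\<forall>i j. 0 \<le> X $ i $ j) \<and> (\<forall>i. (\<Sum>j\<in>UNIV. X $ i $ j) = r $ i) \<and>
     (\<forall>j. (\<Sum>i\<in>UNIV. X $ i $ j) = c $ j)"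
  by (auto simp: transport_polytope_def less_eq_vec_def vec_eq_iff matrix_vector_mult_def
      transpose_def)

lemma compact_transport_polytope:
  fixes r :: "real^'m" and c :: "real^'n"
  shows "compact (transport_polytope r c)"
proof -
  have "closed {X :: real^'n^'m. 0 \<le> X $ i $ j}" for i j
    by (intro closed_Collect_le continuous_intros)
  moreover have "closed {X :: real^'n^'m. (\<Sum>j\<in>UNIV. X $ i $ j) = r $ i}" for i
    by (intro closed_Collect_eq continuous_intros)
  moreover have "closed {X :: real^'n^'m. (\<Sum>i\<in>UNIV. X $ i $ j) = c $ j}" for j
    by (intro closed_Collect_eq continuous_intros)
  moreover have "transport_polytope r c =
      (\<Inter>i j. {X. 0 \<le> X $ i $ j}) \<inter> (\<Inter>i. {X. (\<Sum>j\<in>UNIV. X $ i $ j) = r $ i}) \<inter>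
      (\<Inter>j. {X. (\<Sum>i\<in>UNIV. X $ i $ j) = c $ j})"
    by (auto simp: transport_polytope_iff)
  ultimately have closed: "closed (transport_polytope r c)"
    by (simp add: closed_INT closed_Int)
  have "norm X \<le> (\<Sum>i\<in>UNIV. r $ i)" if X: "X \<in> transport_polytope r c" for X
  proof -
    have "norm X \<le> (\<Sum>i\<in>UNIV. norm (X $ i))"
      unfolding norm_vec_def by (rule L2_set_le_sum) simp
    also have "\<dots> \<le> (\<Sum>i\<in>UNIV. \<Sum>j\<in>UNIV. \<bar>X $ i $ j\<bar>)"
      by (intro sum_mono norm_le_l1_cart)
    also have "\<dots> = (\<Sum>i\<in>UNIV. r $ i)"
      using X by (simp add: transport_polytope_iff)
    finally show ?thesis .
  qed
  then have "bounded (transport_polytope r c)"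
    unfolding bounded_iff by blast
  with closed show ?thesis
    by (simp add: compact_eq_bounded_closed)
qed

lemma ot_value_attained:
  assumes "vec_pos r" "vec_pos c" "r \<bullet> 1 = 1" "c \<bullet> 1 = 1"
  shows "\<exists>X \<in> transport_polytope r c. C \<bullet> X = ot_value r c C \<and>
           (\<forall>Y \<in> transport_polytope r c. ot_value r c C \<le> C \<bullet> Y)"
proof -
  have "(\<chi> i j. r $ i * c $ j) \<in> transport_polytope r c"
    using assms
    by (auto simp: transport_polytope_iff vec_pos_def inner_vec_def less_imp_le
        simp flip: sum_distrib_left sum_distrib_right)
  then have "transport_polytope r c \<noteq> {}"
    by blast
  moreover have "continuous_on (transport_polytope r c) (\<lambda>X. C \<bullet> X)"
    by (intro continuous_intros)
  ultimately obtain X where X: "X \<in> transport_polytope r c"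
    "\<forall>Y \<in> transport_polytope r c. C \<bullet> X \<le> C \<bullet> Y"
    using continuous_attains_inf[OF compact_transport_polytope] by blast
  then have "ot_value r c C = C \<bullet> X"
    unfolding ot_value_def by (intro Least_equality) auto
  with X show ?thesis by auto
qed

end

theory Submission
  imports Defs
begin

text \<open>
  Dual feasibility holds because \<open>A\<^sub>i K\<^sub>i\<^sub>j\<close> is one of the nonnegative terms of \<open>(K\<^sup>T A)\<^sub>j\<close>. The plan
  \<open>Z\<close> already has row marginal \<open>r\<close> and cost \<open>\<langle>t, w\<rangle>\<close>; it is repaired by taking the surplus
  \<open>(s - c)\<^sup>+\<close> proportionally out of the overfull columns and redistributing, within each row, what
  was removed over the deficient columns in proportion to \<open>(c - s)\<^sup>+\<close>. The mass moved is \<open>\<delta>\<close>, so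
  the cost grows by at most \<open>osc C * \<delta>\<close>.
\<close>

lemma inner_matrix: "(X :: real^'n^'m) \<bullet> Y = (\<Sum>i\<in>UNIV. \<Sum>j\<in>UNIV. X $ i $ j * Y $ i $ j)"
  by (simp add: inner_vec_def)

lemma sum_marginals_eq:
  assumes "X \<in> transport_polytope r c"
  shows "(\<Sum>i\<in>UNIV. r $ i) = (\<Sum>j\<in>UNIV. c $ j)"
proof -
  have "(\<Sum>i\<in>UNIV. r $ i) = (\<Sum>i\<in>UNIV. \<Sum>j\<in>UNIV. X $ i $ j)"
    using assms by (simp add: transport_polytope_iff)
  also have "\<dots> = (\<Sum>j\<in>UNIV. \<Sum>i\<in>UNIV. X $ i $ j)"
    by (rule sum.swap)
  finally show ?thesis
    using assms by (simp add: transport_polytope_iff)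
qed

text \<open>The marginal constraints on \<open>X\<close> rewrite the dual objective as the sum of
  \<open>(f $ i + g $ j) * X $ i $ j\<close>; as \<open>X\<close> is nonnegative, dual feasibility
  bounds it term by term.\<close>

lemma kantorovich_weak_duality:
  assumes fg: "(f, g) \<in> kantorovich_dual_feasible C" and X: "X \<in> transport_polytope r c"
  shows "r \<bullet> f + c \<bullet> g \<le> C \<bullet> X"
proof -
  have "r \<bullet> f = (\<Sum>i\<in>UNIV. \<Sum>j\<in>UNIV. f $ i * X $ i $ j)"
    using X by (simp add: transport_polytope_iff inner_vec_def mult.commute flip: sum_distrib_left)
  moreover have "c \<bullet> g = (\<Sum>j\<in>UNIV. \<Sum>i\<in>UNIV. g $ j * X $ i $ j)"
    using X by (simp add: transport_polytope_iff inner_vec_def mult.commute flip: sum_distrib_left)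
  moreover have "(\<Sum>j\<in>UNIV. \<Sum>i\<in>UNIV. g $ j * X $ i $ j) = (\<Sum>i\<in>UNIV. \<Sum>j\<in>UNIV. g $ j * X $ i $ j)"
    by (rule sum.swap)
  ultimately have "r \<bullet> f + c \<bullet> g = (\<Sum>i\<in>UNIV. \<Sum>j\<in>UNIV. (f $ i + g $ j) * X $ i $ j)"
    by (simp add: sum.distrib distrib_right)
  also have "\<dots> \<le> C \<bullet> X"
    using fg X unfolding inner_matrix
    by (intro sum_mono mult_right_mono) (auto simp: kantorovich_dual_feasible_def transport_polytope_iff)
  finally show ?thesis .
qed

text \<open>Each unit of mass in \<open>F\<close> costs at most the largest entry of
  \<open>C\<close>, each unit in \<open>E\<close> at least the smallest. Equal total mass combines
  these two bounds into the oscillation, whatever the signs in \<open>C\<close>.\<close>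

lemma transport_cost_diff_le:
  fixes C E F :: "real^'n^'m"
  assumes "\<And>i j. 0 \<le> E $ i $ j" and "\<And>i j. 0 \<le> F $ i $ j"
    and "(\<Sum>i\<in>UNIV. \<Sum>j\<in>UNIV. E $ i $ j) = d" and "(\<Sum>i\<in>UNIV. \<Sum>j\<in>UNIV. F $ i $ j) = d"
  shows "C \<bullet> F - C \<bullet> E \<le> osc C * d"
proof -
  let ?S = "{C $ i $ j | i j. True}"
  have "?S = (\<lambda>(i, j). C $ i $ j) ` UNIV"
    by auto
  then have "finite ?S"
    by simp
  then have max: "C $ i $ j \<le> Max ?S" and min: "Min ?S \<le> C $ i $ j" for i j
    by (auto intro!: Max_ge Min_le)
  have "C \<bullet> F \<le> (\<Sum>i\<in>UNIV. \<Sum>j\<in>UNIV. Max ?S * F $ i $ j)"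
    unfolding inner_matrix by (intro sum_mono mult_right_mono max assms)
  moreover have "(\<Sum>i\<in>UNIV. \<Sum>j\<in>UNIV. Min ?S * E $ i $ j) \<le> C \<bullet> E"
    unfolding inner_matrix by (intro sum_mono mult_right_mono min assms)
  ultimately show ?thesis
    using assms(3,4) by (simp add: osc_def left_diff_distrib flip: sum_distrib_left)
qed

lemma transport_repair:
  fixes r :: "real^'m" and c s :: "real^'n" and C Z :: "real^'n^'m"
  assumes Z: "Z \<in> transport_polytope r s" and c: "\<And>j. 0 \<le> c $ j"
    and mass: "(\<Sum>i\<in>UNIV. r $ i) = (\<Sum>j\<in>UNIV. c $ j)"
  shows "\<exists>X \<in> transport_polytope r c. C \<bullet> X \<le> C \<bullet> Z + osc C * (1 / 2 * l1_norm (s - c))"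
proof -
  define d where "d = 1 / 2 * l1_norm (s - c)"
  define p q where "p j = max 0 (s $ j - c $ j)" and "q j = max 0 (c $ j - s $ j)" for j
  have pq0: "0 \<le> p j" "0 \<le> q j" and pq: "p j - q j = s $ j - c $ j"
    and pqabs: "p j + q j = \<bar>s $ j - c $ j\<bar>" for j
    by (auto simp: p_def q_def)
  have Z0: "0 \<le> Z $ i $ j" and rZ: "(\<Sum>j\<in>UNIV. Z $ i $ j) = r $ i"
    and sZ: "(\<Sum>i\<in>UNIV. Z $ i $ j) = s $ j" for i j
    using Z by (simp_all add: transport_polytope_iff)
  have s0: "0 \<le> s $ j" for j
    unfolding sZ[symmetric] by (intro sum_nonneg Z0)
  \<comment> \<open>Here \<open>c \<ge> 0\<close> enters: the fraction \<open>p j / s $ j\<close> to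
    be removed is then at most 1, and \<open>p j\<close> vanishes with \<open>s $ j\<close>.\<close>
  have ps: "p j \<le> s $ j" for j
    using c[of j] s0[of j] by (simp add: p_def)
  \<comment> \<open>Equal total masses of \<open>s\<close> and \<open>c\<close> make surplus and
    deficit equal; together they make up the l1 distance, so each is half of it.\<close>
  have "(\<Sum>j\<in>UNIV. p j) - (\<Sum>j\<in>UNIV. q j) = 0"
    using sum_marginals_eq[OF Z] mass by (simp add: pq flip: sum_subtractf) (simp add: sum_subtractf)
  moreover have "(\<Sum>j\<in>UNIV. p j) + (\<Sum>j\<in>UNIV. q j) = 2 * d"
    by (simp add: pqabs d_def l1_norm_def flip: sum.distrib)
  ultimately have sum_p: "(\<Sum>j\<in>UNIV. p j) = d" and sum_q: "(\<Sum>j\<in>UNIV. q j) = d"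
    by simp_all
  have d0: "0 \<le> d"
    unfolding sum_p[symmetric] by (intro sum_nonneg pq0)
  \<comment> \<open>Division by zero yields zero, which is harmless: \<open>p j = 0\<close> if \<open>s $ j = 0\<close>, and no mass is
    moved if \<open>d = 0\<close>.\<close>
  define E :: "real^'n^'m" where "E = (\<chi> i j. Z $ i $ j * (p j / s $ j))"
  define e where "e i = (\<Sum>j\<in>UNIV. E $ i $ j)" for i
  \<comment> \<open>A normalised product coupling: \<open>e\<close> and \<open>q\<close> both have
    total mass \<open>d\<close>, so dividing by \<open>d\<close> gives \<open>F\<close> exactly
    these marginals.\<close>
  define F :: "real^'n^'m" where "F = (\<chi> i j. e i * (q j / d))"
  have E0: "0 \<le> E $ i $ j" for i j
    by (simp add: E_def Z0 pq0 s0)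
  have EZ: "E $ i $ j \<le> Z $ i $ j" for i j
  proof -
    have "p j / s $ j \<le> 1"
      using ps[of j] s0[of j] by (auto simp: divide_le_eq_1)
    then show ?thesis
      unfolding E_def using mult_left_le[OF _ Z0] by (simp del: times_divide_eq_right)
  qed
  have e0: "0 \<le> e i" for i
    unfolding e_def by (intro sum_nonneg E0)
  have F0: "0 \<le> F $ i $ j" for i j
    by (simp add: F_def e0 pq0 d0)
  have E_col: "(\<Sum>i\<in>UNIV. E $ i $ j) = p j" for j
  proof -
    have "s $ j * (p j / s $ j) = p j"
      using ps[of j] pq0(1)[of j] by (cases "s $ j = 0") simp_all
    then show ?thesis
      by (simp add: E_def sZ del: times_divide_eq_right flip: sum_distrib_right)
  qed
  have sum_e: "(\<Sum>i\<in>UNIV. e i) = d"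
    unfolding e_def by (subst sum.swap) (simp add: E_col sum_p)
  have F_row: "(\<Sum>j\<in>UNIV. F $ i $ j) = e i" for i
  proof (cases "d = 0")
    case True
    then have "e i = 0"
      using sum_e e0 by (simp add: sum_nonneg_eq_0_iff)
    then show ?thesis by (simp add: F_def)
  qed (simp add: F_def sum_q flip: sum_distrib_left sum_divide_distrib)
  have F_col: "(\<Sum>i\<in>UNIV. F $ i $ j) = q j" for j
  proof (cases "d = 0")
    case True
    then have "q j = 0"
      using sum_q pq0 by (simp add: sum_nonneg_eq_0_iff)
    then show ?thesis by (simp add: F_def)
  next
    case False
    have "(\<Sum>i\<in>UNIV. F $ i $ j) = d * (q j / d)"
      by (simp add: F_def sum_e del: times_divide_eq_right flip: sum_distrib_right)
    with False show ?thesis by simp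
  qed
  have "C \<bullet> F - C \<bullet> E \<le> osc C * d"
    using sum_e by (intro transport_cost_diff_le E0 F0) (simp_all add: F_row e_def)
  \<comment> \<open>Row \<open>i\<close> loses and regains \<open>e i\<close>, so the row sums stay
    \<open>r\<close>; column \<open>j\<close> changes by \<open>q j - p j = c $ j - s $ j\<close>.
    Nonnegativity comes from \<open>E \<le> Z\<close>.\<close>
  moreover have "Z - E + F \<in> transport_polytope r c"
  proof -
    have "s $ j - p j + q j = c $ j" for j
      using pq[of j] by simp
    moreover have "0 \<le> Z $ i $ j - E $ i $ j + F $ i $ j" for i j
      using EZ[of i j] F0[of i j] by simp
    ultimately show ?thesis
      by (simp add: transport_polytope_iff sum.distrib sum_subtractf rZ sZ E_col F_row F_col
          flip: e_def)
  qed
  ultimately show ?thesis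
    by (intro bexI[of _ "Z - E + F"]) (simp_all add: d_def algebra_simps)
qed

lemma gibbs_kernel_nth: "gibbs_kernel \<epsilon> C $ i $ j = exp (- C $ i $ j / \<epsilon>)"
  by (simp add: gibbs_kernel_def map_matrix_def)

lemma diag_mult_nth:
  "(diag_mat a ** K ** diag_mat t) $ i $ j = a $ i * K $ i $ j * t $ j"
  by (simp add: matrix_matrix_mult_def diag_mat_def if_distrib if_distribR cong: if_cong)

text \<open>The factor \<open>c\<close> cancels in \<open>B \<oslash> c\<close>, leaving the
  reciprocal of \<open>transpose K *v A\<close>. The constraint is thus the logarithm of the bound
  of one summand by the whole column sum, scaled by \<epsilon>.\<close>

lemma gibbs_potentials_dual_feasible:
  assumes \<epsilon>: "\<epsilon> > 0" and K: "K = gibbs_kernel \<epsilon> C" and A: "vec_pos A" and c: "vec_pos c"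
    and B: "B = c \<oslash> (transpose K *v A)"
  shows "(\<epsilon> *\<^sub>R vec_map ln A, \<epsilon> *\<^sub>R vec_map ln (B \<oslash> c)) \<in> kantorovich_dual_feasible C"
proof -
  have "\<epsilon> * ln (A $ i) + \<epsilon> * ln (B $ j / c $ j) \<le> C $ i $ j" for i j
  proof -
    let ?S = "\<Sum>k\<in>UNIV. K $ k $ j * A $ k"
    have pos: "0 < K $ k $ j * A $ k" for k
      using A by (simp add: K gibbs_kernel_nth vec_pos_def)
    have le: "K $ i $ j * A $ i \<le> ?S"
      by (rule member_le_sum) (auto intro: less_imp_le pos)
    have S: "0 < ?S"
      using pos[of i] le by linarith
    have "B $ j / c $ j = 1 / ?S"
      using c by (simp add: B vec_quot_def matrix_vector_mult_def transpose_def vec_pos_def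
          less_imp_neq[symmetric])
    then have "\<epsilon> * ln (A $ i) + \<epsilon> * ln (B $ j / c $ j) = \<epsilon> * (ln (A $ i) - ln ?S)"
      using S by (simp add: ln_div algebra_simps)
    also have "\<dots> \<le> \<epsilon> * (C $ i $ j / \<epsilon>)"
    proof (intro mult_left_mono)
      have "ln (K $ i $ j * A $ i) \<le> ln ?S"
        using le pos[of i] S by simp
      moreover have "ln (K $ i $ j * A $ i) = - C $ i $ j / \<epsilon> + ln (A $ i)"
        using A by (simp add: K gibbs_kernel_nth vec_pos_def ln_mult less_imp_neq[symmetric])
      ultimately show "ln (A $ i) - ln ?S \<le> C $ i $ j / \<epsilon>"
        by simp
    qed (use \<epsilon> in simp)
    finally show ?thesis
      using \<epsilon> by simp
  qed
  then show ?thesis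
    by (simp add: kantorovich_dual_feasible_def vec_map_def vec_quot_def)
qed

theorem proposition3:
  fixes r A f :: "real^'m" and c B t s w g :: "real^'n"
    and C K Z :: "real^'n^'m" and \<epsilon> \<Omega> \<delta> L U :: real
  assumes "vec_pos r" and "vec_pos c"
    and "r \<bullet> 1 = 1" and "c \<bullet> 1 = 1"
    and "\<epsilon> > 0"
    and "K = gibbs_kernel \<epsilon> C"
    and "vec_pos A" and "vec_pos B" and "vec_pos t"
    and "A = r \<oslash> (K *v t)"
    and "B = c \<oslash> (transpose K *v A)"
    and "\<Omega> \<ge> osc C"
    and "Z = diag_mat A ** K ** diag_mat t"
    and "s = transpose Z *v 1"
    and "f = \<epsilon> *\<^sub>R vec_map ln A"
    and "g = \<epsilon> *\<^sub>R vec_map ln (B \<oslash> c)"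
    and "\<delta> = 1 / 2 * l1_norm (s - c)"
    and "w = transpose (C * K) *v A"
    and "L = r \<bullet> f + c \<bullet> g"
    and "U = t \<bullet> w + \<Omega> * \<delta>"
  shows "(f, g) \<in> kantorovich_dual_feasible C \<and>
         (\<exists>Zhat \<in> transport_polytope r c.
            L \<le> ot_value r c C \<and> ot_value r c C \<le> C \<bullet> Zhat \<and> C \<bullet> Zhat \<le> U \<and>
            0 \<le> C \<bullet> Zhat - ot_value r c C \<and> C \<bullet> Zhat - ot_value r c C \<le> U - L)"
proof -
  have Kpos: "0 < K $ i $ j" for i j
    by (simp add: assms gibbs_kernel_nth)
  have A: "0 < A $ i" and t: "0 < t $ j" for i j
    using assms unfolding vec_pos_def by auto
  have Z_nth: "Z $ i $ j = A $ i * K $ i $ j * t $ j" for i j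
    unfolding \<open>Z = _\<close> by (rule diag_mult_nth)
  \<comment> \<open>The scaling equation for \<open>A\<close> is the row constraint in disguise;
    positivity of \<open>K *v t\<close> allows the division to be undone.\<close>
  have "(\<Sum>j\<in>UNIV. Z $ i $ j) = r $ i" for i
  proof -
    let ?S = "\<Sum>j\<in>UNIV. K $ i $ j * t $ j"
    have "A $ i = r $ i / ?S"
      by (subst \<open>A = _\<close>) (simp add: vec_quot_def matrix_vector_mult_def)
    moreover have "0 < ?S"
      by (intro sum_pos) (simp_all add: Kpos t)
    ultimately have "A $ i * ?S = r $ i"
      by simp
    then show ?thesis
      by (simp add: Z_nth mult.assoc flip: sum_distrib_left)
  qed
  then have "Z \<in> transport_polytope r s"
    unfolding transport_polytope_iff
    by (auto simp: \<open>s = _\<close> matrix_vector_mult_def transpose_def)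
      (simp add: Z_nth A t Kpos less_imp_le)
  moreover have "\<And>j. 0 \<le> c $ j" and "(\<Sum>i\<in>UNIV. r $ i) = (\<Sum>j\<in>UNIV. c $ j)"
    using \<open>vec_pos c\<close> \<open>r \<bullet> 1 = 1\<close> \<open>c \<bullet> 1 = 1\<close>
    by (simp_all add: vec_pos_def less_imp_le inner_vec_def)
  ultimately obtain X where X: "X \<in> transport_polytope r c" "C \<bullet> X \<le> C \<bullet> Z + osc C * \<delta>"
    unfolding \<open>\<delta> = _\<close> using transport_repair by blast
  \<comment> \<open>Summing over rows first lets \<open>t $ j\<close> factor out of column
    \<open>j\<close>; what remains is \<open>w $ j\<close>.\<close>
  have "C \<bullet> Z = (\<Sum>j\<in>UNIV. \<Sum>i\<in>UNIV. C $ i $ j * Z $ i $ j)"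
    unfolding inner_matrix by (rule sum.swap)
  also have "\<dots> = t \<bullet> w"
    by (simp add: \<open>w = _\<close> Z_nth inner_vec_def matrix_vector_mult_def transpose_def sum_distrib_left
        mult_ac)
  finally have "C \<bullet> Z = t \<bullet> w" .
  moreover have "osc C * \<delta> \<le> \<Omega> * \<delta>"
    using \<open>\<Omega> \<ge> osc C\<close> by (intro mult_right_mono) (simp_all add: \<open>\<delta> = _\<close> l1_norm_def sum_nonneg)
  ultimately have upper: "C \<bullet> X \<le> U"
    using X(2) by (simp add: \<open>U = _\<close>)
  have dual: "(f, g) \<in> kantorovich_dual_feasible C"
    unfolding \<open>f = _\<close> \<open>g = _\<close>
    by (rule gibbs_potentials_dual_feasible) fact+
  \<comment> \<open>Weak duality at a minimiser \<open>Y\<close> puts \<open>L\<close> below the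
    optimal value itself, not merely below the cost of the repaired plan \<open>X\<close>.\<close>
  obtain Y where "Y \<in> transport_polytope r c" "C \<bullet> Y = ot_value r c C"
    and opt: "\<forall>X \<in> transport_polytope r c. ot_value r c C \<le> C \<bullet> X"
    using ot_value_attained[of r c C] assms(1-4) by blast
  then have "L \<le> ot_value r c C"
    using kantorovich_weak_duality[OF dual] \<open>L = _\<close> by metis
  moreover have "ot_value r c C \<le> C \<bullet> X"
    using opt X(1) by blast
  ultimately show ?thesis
    using dual upper X(1) by (intro conjI bexI[of _ X]) auto
qed

end
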